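(* For every integer $k \ge 4$, $\gamma(k) \le (2k-2)\,\gamma(k-1) + 6$.
   Context: For words $C,S$, $C$ is an \emph{s-cover} (subsequence cover) of $S$ if for every position $i$ of $S$ there exist indices $j_0<j_1<\dots<j_{|C|-1}$ with $S[j_t]=C[t]$ for all $t$ and $i\in\{j_0,\dots,j_{|C|-1}\}$ (i.e., every position of $S$ lies in some occurrence of $C$ as a subsequence). An s-cover $C$ of $S$ is \emph{non-trivial} if $|C|<|S|$. A word is \emph{s-primitive} if it has no non-trivial s-cover. $\gamma(k)$ denotes the maximum length of an s-primitive word over an alphabet of size $k$ (this maximum is finite). *)

theory Defs
  imports Main
begin

definition occurrence :: "'a list \<Rightarrow> 'a list \<Rightarrow> nat set \<Rightarrow> bool" where
  "occurrence C S J \<longleftrightarrow> (\<exists>j :: nat \<Rightarrow> nat.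
      strict_mono_on {..<length C} j \<and>
      (\<forall>t < length C. j t < length S \<and> S ! (j t) = C ! t) \<and>
      J = j ` {..<length C})"

definition s_cover :: "'a list \<Rightarrow> 'a list \<Rightarrow> bool" where
  "s_cover C S \<longleftrightarrow> (\<forall>i < length S. \<exists>J. occurrence C S J \<and> i \<in> J)"

definition s_primitive :: "'a list \<Rightarrow> bool" where
  "s_primitive S \<longleftrightarrow> \<not> (\<exists>C. s_cover C S \<and> length C < length S)"

(* maximum length of an s-primitive word over an alphabet of size k,
   taken as the alphabet {0..<k}; the set is finite, so Sup is its maximum *)
definition gamma :: "nat \<Rightarrow> nat" where
  "gamma k = Sup {length S | S :: nat list. set S \<subseteq> {0..<k} \<and> s_primitive S}"

end

theory Submission
  imports Defs "HOL-Library.Sublist"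
begin

text \<open>
  Let \<open>g = gamma (k - 1)\<close>. Factors of s-primitive words are s-primitive, so a factor that misses a
  letter has length at most \<open>g\<close>. Hence, from any position, a word without equal neighbours that
  starts with a different letter is found as a subsequence by advancing at most \<open>g\<close> positions per
  letter.

  Let \<open>F\<close> and \<open>L\<close> list the letters of \<open>T\<close> in the order of their first and last occurrences, and
  consider \<open>C = F L\<close>. A position carrying the letter \<open>x\<close> is covered through \<open>F\<close> if the part of
  \<open>F\<close> after \<open>x\<close> fits before the last occurrences, and through \<open>L\<close> if the part of \<open>L\<close> before
  \<open>x\<close> fits after the first occurrences. If these two parts together have at most \<open>N\<close> letters and
  \<open>(N + 2) g \<le> |T|\<close>, one of the two always works. In general \<open>N = 2 k - 2\<close>, which yields finiteness of
  \<open>gamma\<close>. The value \<open>N = 2 k - 4\<close> is available unless one of the extreme letters of \<open>T\<close>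
  coincides with one of the two letters at the opposite end; as s-primitive words are square-free,
  such a coincidence can be avoided by removing at most six letters from the two ends.
\<close>

section \<open>Covers in terms of subsequences\<close>

lemma subseq_if_strict_mono_on:
  assumes "strict_mono_on {..<length C} j"
    and "\<And>t. t < length C \<Longrightarrow> j t < length S \<and> S ! j t = C ! t"
  shows "subseq C S"
  using assms
proof (induction C arbitrary: S rule: rev_induct)
  case (snoc c C)
  let ?n = "j (length C)"
  have n: "?n < length S" "S ! ?n = c"
    using snoc.prems(2)[of "length C"] by auto
  have "subseq C (take ?n S)"
  proof (rule snoc.IH)
    show "strict_mono_on {..<length C} j"
      using snoc.prems(1) by (auto simp: strict_mono_on_def)
    fix t assume t: "t < length C"
    then have "j t < ?n"
      using strict_mono_onD[OF snoc.prems(1), of t "length C"] by simp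
    then show "j t < length (take ?n S) \<and> take ?n S ! j t = C ! t"
      using snoc.prems(2)[of t] t n by (simp add: nth_append)
  qed
  moreover have "S = take ?n S @ c # drop (Suc ?n) S"
    using n id_take_nth_drop by blast
  ultimately show ?case
    by (metis append.right_neutral list_emb_append_mono subseq_Cons2 list_emb_Nil)
qed simp

lemma strict_mono_on_if_subseq:
  assumes "subseq C S"
  shows "\<exists>j. strict_mono_on {..<length C} j \<and> (\<forall>t < length C. j t < length S \<and> S ! j t = C ! t)"
  using assms
proof (induction rule: list_emb.induct)
  case (list_emb_Nil S)
  then show ?case by (auto simp: strict_mono_on_def)
next
  case (list_emb_Cons C S a)
  then obtain j where "strict_mono_on {..<length C} j"
      "\<forall>t < length C. j t < length S \<and> S ! j t = C ! t"
    by blast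
  then show ?case
    by (intro exI[of _ "\<lambda>t. Suc (j t)"]) (auto simp: strict_mono_on_def)
next
  case (list_emb_Cons2 c a C S)
  then obtain j where "strict_mono_on {..<length C} j"
      "\<forall>t < length C. j t < length S \<and> S ! j t = C ! t"
    by blast
  with list_emb_Cons2 show ?case
    by (intro exI[of _ "case_nat 0 (\<lambda>t. Suc (j t))"])
      (auto simp: strict_mono_on_def split: nat.splits)
qed

text \<open>Splitting an occurrence at the position it has to cover removes the index functions: the
  letters on either side embed separately into \<open>p\<close> and \<open>q\<close>. Later cover
  arguments use this form.\<close>

lemma s_cover_iff:
  "s_cover C S \<longleftrightarrow>
    (\<forall>p x q. S = p @ x # q \<longrightarrow> (\<exists>u v. C = u @ x # v \<and> subseq u p \<and> subseq v q))"
proof (intro iffI allI impI)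
  fix p x q
  assume cov: "s_cover C S" and S: "S = p @ x # q"
  have "length p < length S"
    using S by simp
  then obtain J where "occurrence C S J" "length p \<in> J"
    using cov unfolding s_cover_def by blast
  then obtain j t where j: "strict_mono_on {..<length C} j"
      "\<And>t. t < length C \<Longrightarrow> j t < length S \<and> S ! j t = C ! t"
    and t: "t < length C" "j t = length p"
    unfolding occurrence_def by (metis imageE lessThan_iff)
  have "subseq (take t C) p"
  proof (rule subseq_if_strict_mono_on)
    show "strict_mono_on {..<length (take t C)} j"
      using j(1) by (auto simp: strict_mono_on_def)
    fix s assume s: "s < length (take t C)"
    then have "j s < length p"
      using strict_mono_onD[OF j(1), of s t] t by simp
    then show "j s < length p \<and> p ! j s = take t C ! s"
      using j(2)[of s] s S by (simp add: nth_append)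
  qed
  moreover have "subseq (drop (Suc t) C) q"
  proof (rule subseq_if_strict_mono_on)
    \<comment> \<open>Letters after the \<open>t\<close>-th sit beyond position
      \<open>length p\<close>, so the truncated subtraction below loses nothing.\<close>
    have gt: "length p < j (s + Suc t)" if "s + Suc t < length C" for s
      using strict_mono_onD[OF j(1), of t "s + Suc t"] t that by simp
    show "strict_mono_on {..<length (drop (Suc t) C)} (\<lambda>s. j (s + Suc t) - Suc (length p))"
    proof (rule strict_mono_onI)
      fix r s
      assume "r \<in> {..<length (drop (Suc t) C)}" "s \<in> {..<length (drop (Suc t) C)}" "r < s"
      then have rs: "r + Suc t < length C" "s + Suc t < length C" "r + Suc t < s + Suc t"
        by auto
      then have "j (r + Suc t) < j (s + Suc t)"
        using strict_mono_onD[OF j(1), of "r + Suc t" "s + Suc t"] by simp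
      with gt[OF rs(1)] show "j (r + Suc t) - Suc (length p) < j (s + Suc t) - Suc (length p)"
        by linarith
    qed
    fix s assume s: "s < length (drop (Suc t) C)"
    then have "length p < j (s + Suc t)"
      using gt[of s] by simp
    then obtain d where "j (s + Suc t) = Suc (length p) + d"
      by (metis Suc_leI le_Suc_ex)
    then show "j (s + Suc t) - Suc (length p) < length q \<and>
        q ! (j (s + Suc t) - Suc (length p)) = drop (Suc t) C ! s"
      using j(2)[of "s + Suc t"] s S by (simp add: nth_append add.commute)
  qed
  moreover have "C = take t C @ x # drop (Suc t) C"
    using j(2)[OF t(1)] t S id_take_nth_drop[OF t(1)] by simp
  ultimately show "\<exists>u v. C = u @ x # v \<and> subseq u p \<and> subseq v q"
    by blast
next
  assume *: "\<forall>p x q. S = p @ x # q \<longrightarrow> (\<exists>u v. C = u @ x # v \<and> subseq u p \<and> subseq v q)"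
  show "s_cover C S"
    unfolding s_cover_def
  proof (intro allI impI)
    fix i assume i: "i < length S"
    define p q where "p = take i S" and "q = drop (Suc i) S"
    have S: "S = p @ S ! i # q" and p: "length p = i"
      using i id_take_nth_drop[OF i] by (simp_all add: p_def q_def)
    obtain u v where C: "C = u @ S ! i # v" and u: "subseq u p" and v: "subseq v q"
      using * S by blast
    obtain j where j: "strict_mono_on {..<length u} j" "\<forall>t < length u. j t < i \<and> p ! j t = u ! t"
      using strict_mono_on_if_subseq[OF u] p by auto
    obtain h where h: "strict_mono_on {..<length v} h"
        "\<forall>t < length v. h t < length q \<and> q ! h t = v ! t"
      using strict_mono_on_if_subseq[OF v] by auto
    define f where "f t = (if t < length u then j t
      else if t = length u then i else Suc i + h (t - Suc (length u)))" for t
    have "strict_mono_on {..<length C} f"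
    proof (rule strict_mono_onI)
      fix r s assume rs: "r \<in> {..<length C}" "s \<in> {..<length C}" "r < s"
      consider "s < length u" | "s = length u" | "r \<le> length u" "length u < s" | "length u < r"
        using rs(3) by linarith
      then show "f r < f s"
      proof cases
        case 1
        then show ?thesis using j(1) rs by (auto simp: f_def strict_mono_on_def)
      next
        case 2
        then show ?thesis using j(2) rs by (auto simp: f_def)
      next
        case 3
        have "f r \<le> i" using 3 j(2) by (auto simp: f_def less_imp_le)
        then show ?thesis using 3 by (simp add: f_def)
      next
        case 4
        then have "r - Suc (length u) < s - Suc (length u)" "s - Suc (length u) < length v"
          using rs C by auto
        then show ?thesis
          using strict_mono_onD[OF h(1), of "r - Suc (length u)" "s - Suc (length u)"] 4 rs
          by (simp add: f_def)
      qed
    qed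
    moreover have "f t < length S \<and> S ! f t = C ! t" if t: "t < length C" for t
    proof -
      consider "t < length u" | "t = length u" | d where "t = Suc (length u) + d"
        using less_iff_Suc_add[of "length u" t] by fastforce
      then show ?thesis
      proof cases
        case 1
        then have "j t < i" "p ! j t = u ! t" using j(2) by auto
        moreover have "S ! j t = p ! j t" using \<open>j t < i\<close> by (simp add: p_def)
        ultimately show ?thesis using 1 i C by (simp add: f_def nth_append)
      next
        case 2
        then show ?thesis using i C by (simp add: f_def)
      next
        case 3
        then have "d < length v" using t C by simp
        then have "h d < length q" "q ! h d = v ! d" using h(2) by auto
        moreover have "S ! (Suc i + h d) = q ! h d"
          using i by (simp add: q_def)
        moreover have "C ! t = v ! d"
          using 3 C by (simp add: nth_append)
        ultimately show ?thesis using 3 i by (simp add: f_def q_def)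
      qed
    qed
    moreover have "i \<in> f ` {..<length C}"
      using C by (intro image_eqI[of _ _ "length u"]) (auto simp: f_def)
    ultimately show "\<exists>J. occurrence C S J \<and> i \<in> J"
      unfolding occurrence_def by blast
  qed
qed

text \<open>A position in \<open>u\<close> or \<open>w\<close> only needs that \<open>C\<close>
  embeds in \<open>S\<close>. This follows from covering any one position of \<open>S\<close>, so
  \<open>S\<close> must be nonempty.\<close>

lemma s_cover_append_both:
  assumes "s_cover C S" "S \<noteq> []"
  shows "s_cover (u @ C @ w) (u @ S @ w)"
  unfolding s_cover_iff
proof (intro allI impI)
  fix p x q assume eq: "u @ S @ w = p @ x # q"
  have sub: "subseq C S"
    using assms unfolding s_cover_iff
    by (metis append_Nil list.exhaust list_emb_Nil2 subseq_Cons2)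
  consider (left) r where "u = p @ x # r" "q = r @ S @ w"
    | (mid) p' q' where "S = p' @ x # q'" "p = u @ p'" "q = q' @ w"
    | (right) r where "w = r @ x # q" "p = u @ S @ r"
    using eq by (auto simp: append_eq_append_conv2 append_eq_Cons_conv Cons_eq_append_conv)
  then show "\<exists>u' v. u @ C @ w = u' @ x # v \<and> subseq u' p \<and> subseq v q"
  proof cases
    case left
    from sub left show ?thesis
      by (intro exI[of _ p] exI[of _ "r @ C @ w"]) (auto intro!: list_emb_append_mono)
  next
    case mid
    then obtain u1 v1 where "C = u1 @ x # v1" "subseq u1 p'" "subseq v1 q'"
      using assms unfolding s_cover_iff by blast
    then show ?thesis using mid
      by (intro exI[of _ "u @ u1"] exI[of _ "v1 @ w"]) (auto intro!: list_emb_append_mono)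
  next
    case right
    from sub right show ?thesis
      by (intro exI[of _ "u @ C @ r"] exI[of _ q]) (auto intro!: list_emb_append_mono)
  qed
qed

section \<open>Closure properties of s-primitive words\<close>

lemma s_cover_map:
  assumes "s_cover C S"
  shows "s_cover (map h C) (map h S)"
proof -
  have "occurrence (map h C) (map h S) J" if "occurrence C S J" for J
    using that unfolding occurrence_def by auto
  with assms show ?thesis
    unfolding s_cover_def length_map by blast
qed

lemma s_primitive_map:
  assumes "s_primitive S" "inj_on h (set S)"
  shows "s_primitive (map h S)"
  unfolding s_primitive_def
proof
  assume "\<exists>C. s_cover C (map h S) \<and> length C < length (map h S)"
  then obtain C where C: "s_cover C (map h S)" "length C < length S"
    by auto
  have "map (inv_into (set S) h) (map h S) = S"
    using assms(2) by (simp add: map_idI)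
  with C(1) have "s_cover (map (inv_into (set S) h) C) S"
    using s_cover_map by metis
  with C(2) assms(1) show False
    unfolding s_primitive_def by auto
qed

text \<open>Replacing the factor by a shorter cover of it would give a shorter cover of the whole
  word.\<close>

lemma s_primitive_factor:
  assumes "s_primitive (u @ v @ w)"
  shows "s_primitive v"
  unfolding s_primitive_def
proof
  assume "\<exists>C. s_cover C v \<and> length C < length v"
  then obtain C where C: "s_cover C v" "length C < length v"
    by auto
  then have "s_cover (u @ C @ w) (u @ v @ w)"
    by (intro s_cover_append_both) auto
  with C(2) assms show False
    unfolding s_primitive_def by auto
qed

text \<open>The copy of \<open>w\<close> containing the position already serves as the
  occurrence.\<close>

lemma s_cover_square: "s_cover w (w @ w)"
  unfolding s_cover_iff
proof (intro allI impI)
  fix p x q assume eq: "w @ w = p @ x # q"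
  consider r where "w = p @ x # r" "q = r @ w" | r where "w = r @ x # q" "p = w @ r"
    using eq by (auto simp: append_eq_append_conv2 append_eq_Cons_conv Cons_eq_append_conv)
  then show "\<exists>u v. w = u @ x # v \<and> subseq u p \<and> subseq v q"
    by cases (blast intro: subseq_rev_drop_many subseq_drop_many)+
qed

lemma s_primitive_squarefree:
  assumes "s_primitive (u @ w @ w @ v)"
  shows "w = []"
  using s_primitive_factor[of u "w @ w" v] assms s_cover_square[of w]
  unfolding s_primitive_def by auto

section \<open>Letters with bounded gaps\<close>

text \<open>Equivalently, every window of \<open>g + 1\<close> consecutive positions contains all of
  \<open>A\<close>. Speaking of factors lets the property pass to factors by reassociation.\<close>

definition gaps_le :: "nat \<Rightarrow> 'a set \<Rightarrow> 'a list \<Rightarrow> bool" where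
  "gaps_le g A S \<longleftrightarrow> (\<forall>c\<in>A. \<forall>u v w. S = u @ v @ w \<longrightarrow> c \<notin> set v \<longrightarrow> length v \<le> g)"

lemma gaps_leD: "gaps_le g A (u @ v @ w) \<Longrightarrow> c \<in> A \<Longrightarrow> c \<notin> set v \<Longrightarrow> length v \<le> g"
  unfolding gaps_le_def by blast

lemma gaps_le_factor:
  assumes "gaps_le g A (u @ v @ w)"
  shows "gaps_le g A v"
  unfolding gaps_le_def
proof (intro ballI allI impI)
  fix c u' v' w' assume "c \<in> A" "v = u' @ v' @ w'" "c \<notin> set v'"
  then show "length v' \<le> g"
    using gaps_leD[of g A "u @ u'" v' "w' @ w" c] assms by simp
qed

text \<open>
  Because consecutive letters of the chain differ, each step advances by at most \<open>g\<close> rather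
  than \<open>g + 1\<close> positions, and the last step cannot land on \<open>l\<close>.
\<close>
lemma subseq_between:
  assumes "gaps_le g A T" "set w \<subseteq> A" "distinct_adj (T ! i # w @ [T ! l])"
    and "i + length w * g \<le> l" "l < length T"
  shows "i < l \<and> subseq w (drop (Suc i) (take l T))"
  using assms(2-4)
proof (induction w arbitrary: i)
  case Nil
  then show ?case by (cases "i = l") auto
next
  case (Cons c w)
  \<comment> \<open>A window of \<open>g + 1\<close> positions must contain \<open>c\<close>. It
    starts at \<open>i\<close>, whose letter is not \<open>c\<close>, so the offset \<open>d\<close>
    lies between 1 and \<open>g\<close>.\<close>
  let ?v = "take (Suc g) (drop i T)"
  have ig: "i + g \<le> l"
    using Cons.prems(3) by simp
  have "gaps_le g A (take i T @ ?v @ drop (Suc g) (drop i T))"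
    using assms(1) by (metis append_take_drop_id)
  moreover have "\<not> length ?v \<le> g"
    using ig assms(5) by simp
  ultimately have "c \<in> set ?v"
    using gaps_leD[of g A _ ?v _ c] Cons.prems(1) by auto
  then obtain d where d: "d \<le> g" "T ! (i + d) = c"
    using ig assms(5) unfolding in_set_conv_nth by (auto simp: less_Suc_eq_le)
  define j where "j = i + d"
  have "d \<noteq> 0"
    using d Cons.prems(2) by (intro notI) simp
  then have j: "i < j" "T ! j = c"
    using d by (auto simp: j_def)
  have "j < l \<and> subseq w (drop (Suc j) (take l T))"
    using Cons.prems d j by (intro Cons.IH) (auto simp: j_def)
  then have jl: "j < l" and w: "subseq w (drop (Suc j) (take l T))"
    by auto
  have "drop j (take l T) = c # drop (Suc j) (take l T)"
    using jl j assms(5) by (simp add: Cons_nth_drop_Suc[symmetric])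
  with w have "subseq (c # w) (drop j (take l T))"
    by simp
  moreover have "drop j (take l T) = drop (j - Suc i) (drop (Suc i) (take l T))"
    using j by simp
  ultimately have "subseq (c # w) (drop (Suc i) (take l T))"
    by (metis append_take_drop_id subseq_drop_many)
  with j jl show ?case by simp
qed

section \<open>Letters ordered by first and last occurrence\<close>

lemma subseq_remdups: "subseq (remdups S) S"
  by (induction S) auto

text \<open>
  The list \<open>remdups S\<close> keeps last occurrences, so it orders the letters of \<open>S\<close> by their last
  occurrence; \<open>rev (remdups (rev S))\<close> orders them by their first occurrence.
\<close>
lemma subseq_after_last_occs:
  assumes "remdups S = u @ x # w" "S = p @ x # q"
  shows "subseq w q"
  using assms
proof (induction p arbitrary: S u)
  case Nil
  show ?case
  \<comment> \<open>If \<open>x\<close> recurs in \<open>q\<close>, the occurrence at hand is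
    dropped and the whole list embeds in \<open>q\<close>; otherwise \<open>x\<close> is its first
    entry.\<close>
  proof (cases "x \<in> set q")
    case True
    then have "remdups q = u @ x # w" using Nil by simp
    then have "subseq (u @ x # w) q" using subseq_remdups by metis
    then show ?thesis
      by (metis subseq_Cons' subseq_drop_many subseq_order.refl subseq_order.trans)
  next
    case False
    then have *: "x # remdups q = u @ x # w" using Nil by simp
    have "u = []"
    proof (cases u)
      case (Cons y u')
      then have "x \<in> set (remdups q)" using * by simp
      with False show ?thesis by simp
    qed simp
    then show ?thesis using * subseq_remdups by auto
  qed
next
  case (Cons a p)
  show ?case
  proof (cases "a \<in> set (p @ x # q)")
    case True
    then show ?thesis using Cons by auto
  next
    case False
    then have *: "a # remdups (p @ x # q) = u @ x # w" using Cons.prems by simp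
    then obtain u' where "remdups (p @ x # q) = u' @ x # w"
      using False by (cases u) auto
    then show ?thesis using Cons.IH by blast
  qed
qed

lemma subseq_rev: "subseq u v \<Longrightarrow> subseq (rev u) (rev v)"
  by (induction rule: list_emb.induct)
    (auto intro: list_emb_append_mono subseq_rev_drop_many)

lemma subseq_before_first_occs:
  assumes "rev (remdups (rev S)) = u @ x # w" "S = p @ x # q"
  shows "subseq u p"
proof -
  have "remdups (rev S) = rev w @ x # rev u"
    using assms(1) by (simp add: rev_swap)
  then have "subseq (rev u) (rev p)"
    by (rule subseq_after_last_occs) (simp add: assms(2))
  then show ?thesis
    using subseq_rev[of "rev u" "rev p"] by simp
qed

section \<open>A criterion against s-primitivity\<close>

lemma distinct_imp_distinct_adj: "distinct xs \<Longrightarrow> distinct_adj xs"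
  by (simp add: distinct_adj_conv_nth nth_eq_iff_index_eq)

text \<open>The two extra \<open>g\<close> in the length bound pay for the stretch before
  \<open>xs\<close> has been read completely and for the stretch after the last point where
  \<open>ls\<close> can start. The second length bound makes the cover, of at most
  \<open>2 * card (set T)\<close> letters, shorter than \<open>T\<close>.\<close>

lemma not_s_primitive_if_gaps_le:
  fixes T :: "'a list"
  assumes gaps: "gaps_le g (set T) T"
    and N: "\<And>x u w u' w'. rev (remdups (rev T)) = u @ x # w \<Longrightarrow> remdups T = u' @ x # w' \<Longrightarrow>
      length w + length u' \<le> N"
    and long: "(N + 2) * g \<le> length T" "2 * card (set T) < length T"
  shows "\<not> s_primitive T"
proof -
  define fs where "fs = rev (remdups (rev T))"
  define ls where "ls = remdups T"
  have T: "T \<noteq> []"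
    using long(2) by auto
  have fs: "distinct fs" "set fs = set T" "fs \<noteq> []"
    and ls: "distinct ls" "set ls = set T" "ls \<noteq> []"
    using T by (simp_all add: fs_def ls_def)
  obtain z zs where ls_eq: "ls = z # zs"
    using ls(3) by (cases ls) auto
  have before: "subseq u p" if "fs = u @ x # w" "T = p @ x # q" for u p x w q
    using that subseq_before_first_occs unfolding fs_def by metis
  have after: "subseq w q" if "ls = u @ x # w" "T = p @ x # q" for u p x w q
    using that subseq_after_last_occs unfolding ls_def by metis
  \<comment> \<open>Merging a common letter ensures \<open>last xs \<noteq> z\<close>, as the chain from \<open>xs\<close> to \<open>ls\<close> requires.\<close>
  define xs where "xs = (if last fs = z then butlast fs else fs)"
  define e where "e = (if last fs = z then [last fs] else [])"
  define C where "C = xs @ ls"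
  have fs_eq: "fs = xs @ e"
    using fs(3) unfolding xs_def e_def by (metis append_Nil2 append_butlast_last_id)
  have last_xs: "last xs \<noteq> z" if "xs \<noteq> []"
  proof (cases "last fs = z")
    case True
    then have "e = [z]" by (simp add: e_def)
    then have "fs = xs @ [z]" using fs_eq by simp
    then have "z \<notin> set xs" using fs(1) by simp
    with that show ?thesis by (metis last_in_set)
  qed (simp add: xs_def)
  \<comment> \<open>\<open>z\<close> heads \<open>ls\<close>, so no letter has an earlier last
    occurrence: all of \<open>ls\<close> is readable from \<open>l\<close> on, and at most
    \<open>g\<close> positions follow \<open>l\<close>.\<close>
  obtain pl ql where l: "T = pl @ z # ql" "z \<notin> set ql"
    using split_list_last[of z T] ls(2) ls_eq by auto
  define l where "l = length pl"
  have "length ql \<le> g"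
    using gaps_leD[of g "set T" "pl @ [z]" ql "[]" z] gaps l by simp
  then have l_ge: "length T \<le> l + 1 + g"
    using l(1) l_def by simp
  have Tl: "l < length T" "T ! l = z"
    using l(1) by (simp_all add: l_def)
  have "drop l T = z # ql"
    using l(1) by (simp add: l_def)
  moreover have "subseq (zs) ql"
    using after[of "[]" z zs pl ql] ls_eq l(1) by simp
  ultimately have ls_sub: "subseq ls (drop l T)"
    by (simp add: ls_eq)
  have "s_cover C T"
    unfolding s_cover_iff
  proof (intro allI impI)
    fix p x q assume Tx: "T = p @ x # q"
    define i where "i = length p"
    have i: "i < length T" "T ! i = x" "p = take i T" "q = drop (Suc i) T"
      using Tx by (simp_all add: i_def)
    show "\<exists>u v. C = u @ x # v \<and> subseq u p \<and> subseq v q"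
    proof (cases "x \<in> set xs")
      \<comment> \<open>Here \<open>x\<close> is the merged letter: all other letters have appeared
        before any occurrence of \<open>x\<close>, and all appear again after it.\<close>
      case False
      moreover have "x \<in> set fs" using Tx fs(2) by simp
      ultimately have "x \<in> set e" using fs_eq by simp
      then have "e = [x]" "x = z"
        by (auto simp: e_def split: if_splits)
      then have "fs = xs @ x # []" "ls = [] @ x # zs"
        using fs_eq ls_eq by auto
      then have "subseq xs p" "subseq (zs) q" "C = xs @ x # zs"
        using before after Tx by (blast, blast, simp add: C_def)
      then show ?thesis by blast
    next
      case True
      then obtain u w where xs_eq: "xs = u @ x # w"
        using split_list by metis
      obtain u' w' where ls_split: "ls = u' @ x # w'"
        using split_list[of x ls] ls(2) Tx by auto
      have "rev (remdups (rev T)) = u @ x # (w @ e)"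
        using fs_eq xs_eq by (simp add: fs_def)
      then have "length (w @ e) + length u' \<le> N"
        using N ls_split unfolding ls_def by blast
      then have "(length w + length u') * g \<le> N * g"
        by (intro mult_right_mono) auto
      then have sum: "length w * g + length u' * g \<le> N * g"
        by (simp add: add_mult_distrib)
      have up: "subseq u p"
        using before[of u x "w @ e" p q] fs_eq xs_eq Tx by simp
      have w'q: "subseq w' q"
        using after[of u' x w' p q] ls_split Tx by simp
      obtain ys y where xs_y: "xs = ys @ [y]"
        using True by (metis empty_iff empty_set rev_exhaust)
      then have y_def: "y = last xs"
        by simp
      have y_ls: "y \<noteq> z"
        using last_xs xs_y by simp
      \<comment> \<open>Dually, \<open>y\<close> is the last letter of \<open>xs\<close> to appear,
        so \<open>xs\<close> is readable up to position \<open>f\<close>, which is at most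
        \<open>g\<close>.\<close>
      have "y \<in> set T"
        using xs_y fs_eq fs(2) by auto
      then obtain pf qf where f: "T = pf @ y # qf" "y \<notin> set pf"
        using split_list_first[of y T] by blast
      define f where "f = length pf"
      have f_le: "f \<le> g"
        using gaps_leD[of g "set T" "[]" pf "y # qf" y] gaps f by (simp add: f_def)
      have Tf: "f < length T" "T ! f = y"
        using f(1) by (simp_all add: f_def)
      have "subseq (ys) pf"
        using before[of ys y e pf qf] fs_eq xs_y f(1) by simp
      then have "subseq (ys @ [y]) (pf @ [y])"
        by (intro list_emb_append_mono) auto
      moreover have "take (Suc f) T = pf @ [y]"
        using f(1) by (simp add: f_def)
      ultimately have xs_sub: "subseq xs (take (Suc f) T)"
        using xs_y by simp
      have sets: "set w \<subseteq> set T" "set u' \<subseteq> set T"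
        using fs_eq xs_eq fs(2) ls_split ls(2) by auto
      have "N * g + 2 * g \<le> length T"
        using long(1) by (simp add: add_mult_distrib)
      \<comment> \<open>If both failed, adding the strict inequalities would give
        \<open>l + 2 \<le> f + N * g\<close>, hence \<open>l + 2 \<le> (N + 1) * g\<close>, while
        \<open>l + 1\<close> is at least \<open>(N + 1) * g\<close>.\<close>
      then consider "i + length w * g \<le> l" | "f + length u' * g \<le> i"
        using sum l_ge f_le by linarith
      then show ?thesis
      proof cases
        case 1
        have "distinct (x # w)"
          using fs(1) fs_eq xs_eq by simp
        moreover have "last (x # w) \<noteq> z"
          using y_ls xs_eq by (simp add: y_def)
        ultimately have "distinct_adj ((x # w) @ [z])"
          unfolding distinct_adj_append_iff by (simp add: distinct_imp_distinct_adj)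
        then have il: "i < l" "subseq w (drop (Suc i) (take l T))"
          using subseq_between[OF gaps sets(1), of i l] 1 i(2) Tl by auto
        have "drop (Suc i) T = drop (Suc i) (take l T) @ drop l T"
          using il(1) Tl(1)
          by (metis append_take_drop_id Suc_leI drop_append diff_is_0_eq drop_0 length_take
              less_imp_le_nat min.absorb2)
        then have "subseq (w @ ls) q"
          using il(2) ls_sub i(4) by (simp add: list_emb_append_mono)
        moreover have "C = u @ x # (w @ ls)"
          by (simp add: C_def xs_eq)
        ultimately show ?thesis
          using up by blast
      next
        case 2
        \<comment> \<open>Mirror case: \<open>xs\<close> is read up to \<open>f\<close>, then
          \<open>u'\<close> before \<open>i\<close>. As \<open>u' @ [x]\<close> starts with
          \<open>z\<close>, it may follow \<open>y\<close>.\<close>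
        have "distinct (u' @ [x])"
          using ls(1) ls_split by simp
        moreover have "hd (u' @ [x]) \<noteq> y"
          using y_ls ls_split ls_eq by (cases u') auto
        ultimately have "distinct_adj (y # u' @ [x])"
          by (simp add: distinct_adj_Cons distinct_imp_distinct_adj)
        then have fi: "f < i" "subseq u' (drop (Suc f) (take i T))"
          using subseq_between[OF gaps sets(2), of f i] 2 i(1,2) Tf by auto
        have "p = take (Suc f) T @ drop (Suc f) (take i T)"
          using fi(1) i(3)
          by (metis append_take_drop_id Suc_leI min.absorb1 take_take)
        then have "subseq (xs @ u') p"
          using fi(2) xs_sub by (metis list_emb_append_mono)
        moreover have "C = (xs @ u') @ x # w'"
          by (simp add: C_def ls_split)
        ultimately show ?thesis
          using w'q by blast
      qed
    qed
  qed
  moreover have "length C < length T"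
  proof -
    have "length xs \<le> length fs"
      using fs_eq by simp
    moreover have "length fs = card (set T)" "length ls = card (set T)"
      using distinct_card[OF fs(1)] distinct_card[OF ls(1)] fs(2) ls(2) by simp_all
    ultimately show ?thesis
      using long(2) by (simp add: C_def)
  qed
  ultimately show ?thesis
    unfolding s_primitive_def by blast
qed

section \<open>Trimming both ends\<close>

lemma remdups_append_two:
  assumes "a \<noteq> b"
  shows "\<exists>zs. remdups (ys @ [a, b]) = zs @ [a, b]"
  using assms by (induction ys) auto

text \<open>With \<open>k\<close> letters, \<open>length w + length u'\<close> is
  \<open>2 * k - 2\<close> minus \<open>length u + length w'\<close>, so the latter sum must not be
  0 or 1. Such small values put \<open>x\<close> among the first two and the last two letters of
  \<open>T\<close>; the three cases are the coincidences excluded by \<open>ends\<close>.\<close>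

lemma first_last_occs_length_le:
  assumes "length T \<ge> 2" "T ! 0 \<noteq> T ! 1" "rev T ! 0 \<noteq> rev T ! 1"
    and ends: "T ! 0 \<noteq> rev T ! 0" "T ! 0 \<noteq> rev T ! 1" "T ! 1 \<noteq> rev T ! 0"
    and first: "rev (remdups (rev T)) = u @ x # w" and last: "remdups T = u' @ x # w'"
  shows "length w + length u' \<le> 2 * card (set T) - 4"
proof -
  have two: "\<exists>ys. S = ys @ [rev S ! 1, rev S ! 0]" if "length S \<ge> 2" for S :: "'a list"
  proof -
    have "Suc (Suc 0) \<le> length (rev S)"
      using that by simp
    then obtain a b zs where "rev S = a # b # zs"
      unfolding Suc_le_length_iff by blast
    then have "S = rev zs @ [b, a]"
      by (simp add: rev_swap)
    then show ?thesis
      by simp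
  qed
  obtain zs where zs: "remdups T = zs @ [rev T ! 1, rev T ! 0]"
    using two[OF assms(1)] remdups_append_two assms(3) by metis
  obtain zs' where "remdups (rev T) = zs' @ [T ! 1, T ! 0]"
    using two[of "rev T"] remdups_append_two assms(1,2) by (metis length_rev rev_rev_ident)
  then have zs': "u @ x # w = T ! 0 # T ! 1 # rev zs'"
    using first by simp
  have "length (u @ x # w) = card (set T)" "length (u' @ x # w') = card (set T)"
    using first last by (metis length_remdups_card_conv length_rev set_rev)+
  then have len: "length u + length w + 1 = card (set T)" "length u' + length w' + 1 = card (set T)"
    by auto
  have u0: "x = T ! 0" if "length u = 0"
    using zs' that by simp
  have u1: "x = T ! 1" if "length u = 1"
    using zs' that by (auto simp: length_Suc_conv)
  have "rev (u' @ x # w') = rev (zs @ [rev T ! 1, rev T ! 0])"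
    using zs last by simp
  then have rw: "rev w' @ x # rev u' = rev T ! 0 # rev T ! 1 # rev zs"
    by simp
  have w0: "x = rev T ! 0" if "length w' = 0"
    using rw that by simp
  have w1: "x = rev T ! 1" if "length w' = 1"
    using rw that by (auto simp: length_Suc_conv)
  have "length u + length w' \<ge> 2"
  proof (rule ccontr)
    assume "\<not> ?thesis"
    then consider "length u = 0" "length w' = 0" | "length u = 0" "length w' = 1"
      | "length u = 1" "length w' = 0"
      by linarith
    then show False
      using u0 u1 w0 w1 ends by cases metis+
  qed
  then show ?thesis
    using len by linarith
qed

section \<open>Square-freeness at the two ends\<close>

lemma s_primitive_no_square_nth:
  assumes "s_primitive S" "i + 2 * m \<le> length S" "m > 0"
  shows "\<exists>t<m. S ! (i + t) \<noteq> S ! (i + m + t)"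
proof (rule ccontr)
  assume *: "\<not> ?thesis"
  let ?w = "take m (drop i S)"
  have "?w = take m (drop (i + m) S)"
    using * assms(2) by (intro nth_equalityI) auto
  moreover have "S = take i S @ ?w @ take m (drop (i + m) S) @ drop m (drop (i + m) S)"
    by (metis add.commute append_take_drop_id drop_drop)
  ultimately have "?w = []"
    using assms(1) s_primitive_squarefree by metis
  then show False
    using assms(2,3) by simp
qed

lemma s_primitive_rev:
  assumes "s_primitive S"
  shows "s_primitive (rev S)"
  unfolding s_primitive_def
proof
  assume "\<exists>C. s_cover C (rev S) \<and> length C < length (rev S)"
  then obtain C where C: "s_cover C (rev S)" "length C < length S"
    by auto
  have "s_cover (rev C) S"
    unfolding s_cover_iff
  proof (intro allI impI)
    fix p x q assume "S = p @ x # q"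
    then have "rev S = rev q @ x # rev p"
      by simp
    then obtain u v where "C = u @ x # v" "subseq u (rev q)" "subseq v (rev p)"
      using C(1) unfolding s_cover_iff by blast
    then show "\<exists>u v. rev C = u @ x # v \<and> subseq u p \<and> subseq v q"
      using subseq_rev[of u "rev q"] subseq_rev[of v "rev p"]
      by (intro exI[of _ "rev v"] exI[of _ "rev u"]) simp
  qed
  with C(2) assms show False
    unfolding s_primitive_def by auto
qed

text \<open>
  Here \<open>r\<close> reads the same word from its end. Removing five letters is not always enough: both
  \<open>s\<close> and \<open>r\<close> may start with \<open>abcaba\<close>.
\<close>
lemma squarefree_trimming:
  fixes s r :: "nat \<Rightarrow> 'a"
  assumes s: "\<And>i. i \<le> 6 \<Longrightarrow> s i \<noteq> s (i + 1)"
      "\<And>i. i \<le> 4 \<Longrightarrow> s i \<noteq> s (i + 2) \<or> s (i + 1) \<noteq> s (i + 3)"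
      "s 0 \<noteq> s 3 \<or> s 1 \<noteq> s 4 \<or> s 2 \<noteq> s 5"
    and r: "\<And>i. i \<le> 6 \<Longrightarrow> r i \<noteq> r (i + 1)"
      "\<And>i. i \<le> 4 \<Longrightarrow> r i \<noteq> r (i + 2) \<or> r (i + 1) \<noteq> r (i + 3)"
      "r 0 \<noteq> r 3 \<or> r 1 \<noteq> r 4 \<or> r 2 \<noteq> r 5"
  shows "\<exists>p q. p + q \<le> 6 \<and> s p \<noteq> r q \<and> s p \<noteq> r (q + 1) \<and> s (p + 1) \<noteq> r q"
proof (rule ccontr)
  assume "\<not> ?thesis"
  then have *: "s p = r q \<or> s p = r (q + 1) \<or> s (p + 1) = r q" if "p + q \<le> 6" for p q
    using that by blast
  \<comment> \<open>Only indices up to 7 occur, so all instances of the hypotheses form a finite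
    problem about equalities among sixteen letters.\<close>
  note S = s(1)[of 0] s(1)[of 1] s(1)[of 2] s(1)[of 3] s(1)[of 4] s(1)[of 5] s(1)[of 6]
    s(2)[of 0] s(2)[of 1] s(2)[of 2] s(2)[of 3] s(2)[of 4]
  note R = r(1)[of 0] r(1)[of 1] r(1)[of 2] r(1)[of 3] r(1)[of 4] r(1)[of 5] r(1)[of 6]
    r(2)[of 0] r(2)[of 1] r(2)[of 2] r(2)[of 3] r(2)[of 4]
  note E = *[of 0 0] *[of 0 1] *[of 0 2] *[of 0 3] *[of 0 4] *[of 0 5] *[of 0 6]
    *[of 1 0] *[of 1 1] *[of 1 2] *[of 1 3] *[of 1 4] *[of 1 5]
    *[of 2 0] *[of 2 1] *[of 2 2] *[of 2 3] *[of 2 4]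
    *[of 3 0] *[of 3 1] *[of 3 2] *[of 3 3]
    *[of 4 0] *[of 4 1] *[of 4 2] *[of 5 0] *[of 5 1] *[of 6 0]
  show False
    using S[simplified] R[simplified] E[simplified] s(3) r(3)
    by (simp add: eval_nat_numeral) (smt (z3))
qed

section \<open>Bounding the length of s-primitive words\<close>

text \<open>The bound \<open>g\<close> for smaller alphabets is a hypothesis rather than a value of
  \<open>gamma\<close>, because it is also used in showing that the lengths behind
  \<open>gamma\<close> are bounded.\<close>

lemma s_primitive_gaps_le:
  assumes "s_primitive S" "set S \<subseteq> A"
    and "\<And>c v. c \<in> A \<Longrightarrow> s_primitive v \<Longrightarrow> set v \<subseteq> A - {c} \<Longrightarrow> length v \<le> g"
  shows "gaps_le g A S"
  unfolding gaps_le_def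
proof (intro ballI allI impI)
  fix c u v w assume "c \<in> A" "S = u @ v @ w" "c \<notin> set v"
  moreover from this have "s_primitive v"
    using assms(1) s_primitive_factor by blast
  ultimately show "length v \<le> g"
    using assms(2) by (intro assms(3)[of c]) auto
qed

lemma gaps_le_set_eq:
  assumes "gaps_le g A S" "set S \<subseteq> A" "g < length S"
  shows "set S = A"
proof (rule ccontr)
  assume "set S \<noteq> A"
  then obtain c where "c \<in> A" "c \<notin> set S"
    using assms(2) by blast
  then show False
    using gaps_leD[of g A "[]" S "[]" c] assms(1,3) by simp
qed

text \<open>Neither \<open>w\<close> nor \<open>u'\<close> contains \<open>x\<close>, so
  \<open>N = 2 * card A - 2\<close> always works. This gives the induction step for finiteness of
  \<open>gamma\<close>.\<close>

lemma s_primitive_length_le_crude: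
  assumes "s_primitive S" "set S \<subseteq> A" "finite A" "A \<noteq> {}"
    and "\<And>c v. c \<in> A \<Longrightarrow> s_primitive v \<Longrightarrow> set v \<subseteq> A - {c} \<Longrightarrow> length v \<le> g"
  shows "length S \<le> 2 * card A * g + 2 * card A"
proof (rule ccontr)
  assume long: "\<not> ?thesis"
  have k: "card A \<ge> 1"
    using assms(3,4) by (simp add: Suc_le_eq card_gt_0_iff)
  have gaps: "gaps_le g A S"
    using assms(1,2,5) by (rule s_primitive_gaps_le)
  have "1 * g \<le> 2 * card A * g"
    using k by (intro mult_right_mono) auto
  then have "g < length S"
    using long by linarith
  then have setS: "set S = A"
    using gaps_le_set_eq[OF gaps assms(2)] by blast
  have "\<not> s_primitive S"
  proof (rule not_s_primitive_if_gaps_le[where N = "2 * card A - 2"])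
    show "gaps_le g (set S) S" "2 * card (set S) < length S"
      using gaps long by (simp_all add: setS)
    have "2 * card A - 2 + 2 = 2 * card A"
      using k by simp
    then show "(2 * card A - 2 + 2) * g \<le> length S"
      using long by simp
    fix x u w u' w'
    assume "rev (remdups (rev S)) = u @ x # w" "remdups S = u' @ x # w'"
    then have "length (u @ x # w) = card A" "length (u' @ x # w') = card A"
      by (metis length_remdups_card_conv length_rev set_rev setS)+
    then show "length w + length u' \<le> 2 * card A - 2"
      by simp
  qed
  with assms(1) show False by simp
qed

text \<open>A longer word keeps more than \<open>(2 * k - 2) * g\<close> letters after trimming six.
  With the coincidences at the ends gone, the criterion applies with \<open>N = 2 * k - 4\<close>,
  as \<open>N + 2 = 2 * k - 2\<close>.\<close>

lemma s_primitive_length_le: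
  assumes "s_primitive S" "set S \<subseteq> A" "finite A" "card A \<ge> 4"
    and "\<And>c v. c \<in> A \<Longrightarrow> s_primitive v \<Longrightarrow> set v \<subseteq> A - {c} \<Longrightarrow> length v \<le> g"
  shows "length S \<le> (2 * card A - 2) * g + 6"
proof (rule ccontr)
  assume long: "\<not> ?thesis"
  define k where "k = card A"
  have k: "k \<ge> 4"
    using assms(4) by (simp add: k_def)
  have long: "length S \<ge> (2 * k - 2) * g + 7"
    using long by (simp add: k_def)
  have gaps: "gaps_le g A S"
    using assms(1,2,5) by (rule s_primitive_gaps_le)
  \<comment> \<open>Three letters cannot exhaust an alphabet of at least four.\<close>
  have g: "g \<ge> 3"
  proof -
    have "card (set (take 3 S)) < card A"
      using card_length[of "take 3 S"] assms(4) by simp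
    then obtain c where "c \<in> A" "c \<notin> set (take 3 S)"
      by (metis List.finite_set card_mono leD subsetI)
    then have "length (take 3 S) \<le> g"
      using gaps_leD[of g A "[]" "take 3 S" "drop 3 S" c] gaps by simp
    then show ?thesis
      using long by simp
  qed
  have "(2 * k - 2) * g \<ge> (2 * k - 2) * 3"
    using g by (intro mult_left_mono) auto
  then have len: "(2 * k - 2) * g \<ge> 6 * k - 6"
    by (simp only: diff_mult_distrib)
  have "\<exists>p q. p + q \<le> 6 \<and> S ! p \<noteq> rev S ! q \<and> S ! p \<noteq> rev S ! (q + 1) \<and> S ! (p + 1) \<noteq> rev S ! q"
  proof (rule squarefree_trimming)
    \<comment> \<open>25 is the value of \<open>(2 * k - 2) * g + 7\<close> at the smallest case
      \<open>k = 4\<close>, \<open>g = 3\<close>.\<close>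
    have big: "length S \<ge> 25"
      using long len k by linarith
    have sq: "\<exists>t<m. W ! (i + t) \<noteq> W ! (i + m + t)" if "W = S \<or> W = rev S" "i + 2 * m \<le> 25" "m > 0"
      for W i m
      using s_primitive_no_square_nth[of W i m] that big assms(1) s_primitive_rev[OF assms(1)] by auto
    have sq1: "W ! i \<noteq> W ! (i + 1)" if "W = S \<or> W = rev S" "i \<le> 6" for W i
      using sq[of W i 1] that by auto
    have sq2: "W ! i \<noteq> W ! (i + 2) \<or> W ! (i + 1) \<noteq> W ! (i + 3)" if "W = S \<or> W = rev S" "i \<le> 4" for W i
      using sq[of W i 2] that by (auto simp: less_Suc_eq numeral_2_eq_2 numeral_3_eq_3)
    have sq3: "W ! 0 \<noteq> W ! 3 \<or> W ! 1 \<noteq> W ! 4 \<or> W ! 2 \<noteq> W ! 5" if "W = S \<or> W = rev S" for W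
      using sq[of W 0 3] that by (auto simp: less_Suc_eq eval_nat_numeral)
    show "S ! i \<noteq> S ! (i + 1)" "rev S ! i \<noteq> rev S ! (i + 1)" if "i \<le> 6" for i
      using sq1 that by blast+
    show "S ! i \<noteq> S ! (i + 2) \<or> S ! (i + 1) \<noteq> S ! (i + 3)"
      "rev S ! i \<noteq> rev S ! (i + 2) \<or> rev S ! (i + 1) \<noteq> rev S ! (i + 3)" if "i \<le> 4" for i
      using sq2 that by blast+
    show "S ! 0 \<noteq> S ! 3 \<or> S ! 1 \<noteq> S ! 4 \<or> S ! 2 \<noteq> S ! 5"
      "rev S ! 0 \<noteq> rev S ! 3 \<or> rev S ! 1 \<noteq> rev S ! 4 \<or> rev S ! 2 \<noteq> rev S ! 5"
      using sq3 by blast+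
  qed
  then obtain p q where pq: "p + q \<le> 6"
    and ends: "S ! p \<noteq> rev S ! q" "S ! p \<noteq> rev S ! (q + 1)" "S ! (p + 1) \<noteq> rev S ! q"
    by blast
  define a b where "a = take p S" and "b = drop (length S - q) S"
  define T where "T = drop p (take (length S - q) S)"
  have lenT: "length T = length S - q - p"
    by (simp add: T_def)
  have S: "S = a @ T @ b"
  proof -
    have "take p S = take p (take (length S - q) S)"
      using long len k pq by (simp add: min_def)
    then show ?thesis
      unfolding a_def b_def T_def by (metis append.assoc append_take_drop_id)
  qed
  have lenT_ge: "length T \<ge> (2 * k - 2) * g + 1"
    using lenT long pq by linarith
  have prim: "s_primitive T"
    using assms(1) S s_primitive_factor by metis
  have gapsT: "gaps_le g A T"
    using gaps S gaps_le_factor by metis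
  have "1 * g \<le> (2 * k - 2) * g"
    using k by (intro mult_right_mono) auto
  then have "g < length T"
    using lenT_ge by linarith
  moreover have "set T \<subseteq> A"
    using assms(2) S by auto
  ultimately have setT: "set T = A"
    using gaps_le_set_eq[OF gapsT] by blast
  have T_nth: "T ! i = S ! (p + i)" "rev T ! i = rev S ! (q + i)" if "i < length T" for i
  proof -
    have "length a = p" "length b = q"
      using long len k pq by (auto simp: a_def b_def)
    moreover have "rev S = rev b @ rev T @ rev a"
      using S by simp
    ultimately show "T ! i = S ! (p + i)" "rev T ! i = rev S ! (q + i)"
      using that S by (metis length_rev nth_append nth_append_length_plus)+
  qed
  have T2: "length T \<ge> 2"
    using lenT_ge len k by linarith
  have "\<not> s_primitive T"
  proof (rule not_s_primitive_if_gaps_le[where N = "2 * k - 4"])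
    show "gaps_le g (set T) T"
      using gapsT setT by simp
    have "2 * k - 4 + 2 = 2 * k - 2"
      using k by simp
    then show "(2 * k - 4 + 2) * g \<le> length T"
      using lenT_ge by simp
    have "2 * k < length T"
      using lenT_ge len k by linarith
    then show "2 * card (set T) < length T"
      by (simp add: setT k_def)
    fix x u w u' w'
    assume occs: "rev (remdups (rev T)) = u @ x # w" "remdups T = u' @ x # w'"
    have "T ! 0 \<noteq> T ! 1"
      using s_primitive_no_square_nth[OF prim, of 0 1] T2 by auto
    moreover have "rev T ! 0 \<noteq> rev T ! 1"
      using s_primitive_no_square_nth[OF s_primitive_rev[OF prim], of 0 1] T2 by auto
    moreover have "T \<noteq> []"
      using T2 by auto
    then have "T ! 0 = S ! p" "T ! 1 = S ! (p + 1)"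
      "rev T ! 0 = rev S ! q" "rev T ! 1 = rev S ! (q + 1)"
      using T_nth[of 0] T_nth[of 1] T2 by simp_all
    ultimately have "length w + length u' \<le> 2 * card (set T) - 4"
      using first_last_occs_length_le[OF T2 _ _ _ _ _ occs] ends by metis
    then show "length w + length u' \<le> 2 * k - 4"
      by (simp add: setT k_def)
  qed
  with prim show False by simp
qed

section \<open>Passing to \<open>gamma\<close>\<close>

lemma s_primitive_rename:
  assumes "s_primitive v" "set v \<subseteq> B" "finite B" "card B \<le> m"
  shows "\<exists>v' :: nat list. length v' = length v \<and> set v' \<subseteq> {0..<m} \<and> s_primitive v'"
proof -
  obtain h where h: "bij_betw h B {0..<card B}"
    using ex_bij_betw_finite_nat assms(3) by blast
  then have "inj_on h (set v)" and "h ` set v \<subseteq> {0..<card B}"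
    using assms(2) by (auto simp: bij_betw_def intro: inj_on_subset)
  moreover have "{0..<card B} \<subseteq> {0..<m}"
    using assms(4) by auto
  ultimately show ?thesis
    using s_primitive_map[OF assms(1)] by (intro exI[of _ "map h v"]) auto
qed

text \<open>Needed before the supremum in \<open>gamma\<close> can serve as an upper bound. Over the
  empty alphabet only the empty word exists; the crude bound gives the induction step.\<close>

lemma s_primitive_lengths_bdd_above:
  "bdd_above {length S | S :: nat list. set S \<subseteq> {0..<k} \<and> s_primitive S}"
proof (induction k)
  case (Suc k)
  then obtain g where g: "\<And>S :: nat list. set S \<subseteq> {0..<k} \<Longrightarrow> s_primitive S \<Longrightarrow> length S \<le> g"
    unfolding bdd_above_def by blast
  have "length S \<le> 2 * card {0..<Suc k} * g + 2 * card {0..<Suc k}"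
    if "set S \<subseteq> {0..<Suc k}" "s_primitive S" for S :: "nat list"
  proof (rule s_primitive_length_le_crude[OF that(2,1)])
    fix c :: nat and v
    assume "c \<in> {0..<Suc k}" "s_primitive v" "set v \<subseteq> {0..<Suc k} - {c}"
    then show "length v \<le> g"
      using s_primitive_rename[of v "{0..<Suc k} - {c}" k] g by fastforce
  qed auto
  then show ?case
    unfolding bdd_above_def by blast
qed (auto simp: bdd_above_def)

text \<open>Allows an arbitrary alphabet, since deleting a letter \<open>c\<close> from
  \<open>{0..<k}\<close> need not leave an initial segment.\<close>

lemma length_le_gamma:
  assumes "s_primitive S" "set S \<subseteq> B" "finite B" "card B \<le> k"
  shows "length S \<le> gamma k"
proof -
  obtain S' :: "nat list" where S': "length S' = length S" "set S' \<subseteq> {0..<k}" "s_primitive S'"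
    using s_primitive_rename[OF assms] by blast
  then have "length S' \<le> gamma k"
    unfolding gamma_def by (intro cSup_upper s_primitive_lengths_bdd_above) blast
  with S'(1) show ?thesis by simp
qed

theorem mainTheorem1:
  fixes k :: nat
  assumes "k \<ge> 4"
  shows "gamma k \<le> (2 * k - 2) * gamma (k - 1) + 6"
  unfolding gamma_def[of k]
proof (rule cSup_least)
  \<comment> \<open>\<open>cSup_least\<close> requires a nonempty set, and no word is shorter than
    \<open>[]\<close>.\<close>
  have "s_primitive ([] :: nat list)"
    by (simp add: s_primitive_def)
  then show "{length S | S :: nat list. set S \<subseteq> {0..<k} \<and> s_primitive S} \<noteq> {}"
    by (auto intro!: exI[of _ "[]"])
next
  fix n assume "n \<in> {length S | S :: nat list. set S \<subseteq> {0..<k} \<and> s_primitive S}"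
  then obtain S :: "nat list" where S: "n = length S" "set S \<subseteq> {0..<k}" "s_primitive S"
    by blast
  have "length S \<le> (2 * card {0..<k} - 2) * gamma (k - 1) + 6"
  proof (rule s_primitive_length_le[OF S(3,2)])
    fix c v assume "c \<in> {0..<k}" "s_primitive v" "set v \<subseteq> {0..<k} - {c}"
    then show "length v \<le> gamma (k - 1)"
      by (intro length_le_gamma[where B = "{0..<k} - {c}"]) auto
  qed (use assms in auto)
  then show "n \<le> (2 * k - 2) * gamma (k - 1) + 6"
    by (simp add: S(1))
qed

end
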